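(* Let $p\geq 1$ and $q\geq 0$ be integers. For every $n\geq 0$, the $(p,q)$-Tower of Hanoi with $n$ disks admits a solution (a sequence of $(p,q)$-moves from $(\Delta_n,\varnothing,\varnothing)$ to $(\varnothing,\varnothing,\Delta_n)$), there is exactly one solution of minimal length, and its length is $m_n$, where $(m_n)_{n\in\mathbb{Z}}$ is defined by $m_n=0$ for $n\leq 0$ and $m_n=m_{n-p}+m_{n-p-q}+1$ for $n>0$.
   Context: Disks $1,\dots,n$. For integers $a,b$, $\Delta_b^{a}$ is the set of disks $d$ with $a\leq d\leq b$ (so $\Delta_b^a=\Delta_b=\{1,\dots,b\}$ when $a\leq 1$, and $\varnothing$ when $a>b$); $\Delta_b=\varnothing$ for $b<1$. A state is an ordered triple $(A,B,C)$ of pairwise disjoint sets with union $\Delta_n$ (each peg stacked in decreasing order, top = minimum). A $(p,q)$-move: for some $k\in\Delta_n$ and two distinct pegs $X,Y$ with $X=\Delta_k^{k-p+1}X'$ and $Y=\Delta_{k-p}Y'$ (all disks of $X',Y'$ larger than $k$), and third peg $Z$ containing only disks larger than $k$, the move puts simultaneously all disks of $\Delta_k^{k-p+1-q}$ onto $Z$: $\Delta_k^{k-p+1}X'\sqcup \Delta_{k-p}Y'\sqcup Z\longrightarrow X'\sqcup \Delta_{k-p-q}Y'\sqcup \Delta_k^{k-p+1-q} Z$ (peg positions preserved). The $(p,q)$-Tower of Hanoi is the puzzle where only $(p,q)$-moves are allowed. *)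

theory Defs
  imports Main
begin

text \<open>The disks are the integers \<open>1, \<dots>, n\<close>; \<open>Delta a b\<close> is the set of disks \<open>d\<close> with
  \<open>a \<le> d \<le> b\<close>, for arbitrary integers \<open>a\<close> and \<open>b\<close>. In particular \<open>Delta a b = {1..b}\<close> for
  \<open>a \<le> 1\<close>.\<close>

definition Delta :: "int \<Rightarrow> int \<Rightarrow> int set" where
  "Delta a b = {d. 1 \<le> d \<and> a \<le> d \<and> d \<le> b}"

text \<open>An ordered triple \<open>(A, B, C)\<close> of sets of disks is a function on the three pegs.\<close>

datatype peg = PegA | PegB | PegC

type_synonym state = "peg \<Rightarrow> int set"

definition is_state :: "int \<Rightarrow> state \<Rightarrow> bool" where
  "is_state n s \<longleftrightarrow>
     (\<forall>X Y. X \<noteq> Y \<longrightarrow> s X \<inter> s Y = {}) \<and> s PegA \<union> s PegB \<union> s PegC = Delta 1 n"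

definition initial_state :: "int \<Rightarrow> state" where
  "initial_state n = (\<lambda>X. case X of PegA \<Rightarrow> Delta 1 n | PegB \<Rightarrow> {} | PegC \<Rightarrow> {})"

definition final_state :: "int \<Rightarrow> state" where
  "final_state n = (\<lambda>X. case X of PegA \<Rightarrow> {} | PegB \<Rightarrow> {} | PegC \<Rightarrow> Delta 1 n)"

definition pq_move :: "int \<Rightarrow> int \<Rightarrow> int \<Rightarrow> state \<Rightarrow> state \<Rightarrow> bool" where
  "pq_move p q n s t \<longleftrightarrow> is_state n s \<and>
     (\<exists>k \<in> Delta 1 n. \<exists>X Y Z X' Y'.
        distinct [X, Y, Z] \<and>
        (\<forall>d \<in> X' \<union> Y' \<union> s Z. k < d) \<and>
        s X = Delta (k - p + 1) k \<union> X' \<and>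
        s Y = Delta 1 (k - p) \<union> Y' \<and>
        t X = X' \<and>
        t Y = Delta 1 (k - p - q) \<union> Y' \<and>
        t Z = Delta (k - p + 1 - q) k \<union> s Z)"

text \<open>A move is identified with the pair of states before and after it. This determines \<open>k\<close> and
  the roles of the pegs: \<open>k\<close> is the largest disk that changes pegs, and it goes from \<open>X\<close> to \<open>Z\<close>.\<close>

inductive move_seq :: "int \<Rightarrow> int \<Rightarrow> int \<Rightarrow> state \<Rightarrow> (state \<times> state) list \<Rightarrow> state \<Rightarrow> bool"
  for p q n where
  Nil: "move_seq p q n s [] s"
| Cons: "pq_move p q n s t \<Longrightarrow> move_seq p q n t ms u \<Longrightarrow> move_seq p q n s ((s, t) # ms) u"

definition solution :: "int \<Rightarrow> int \<Rightarrow> int \<Rightarrow> (state \<times> state) list \<Rightarrow> bool" where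
  "solution p q n ms \<longleftrightarrow> move_seq p q n (initial_state n) ms (final_state n)"

definition minimal_solution :: "int \<Rightarrow> int \<Rightarrow> int \<Rightarrow> (state \<times> state) list \<Rightarrow> bool" where
  "minimal_solution p q n ms \<longleftrightarrow>
     solution p q n ms \<and> (\<forall>ms'. solution p q n ms' \<longrightarrow> length ms \<le> length ms')"

text \<open>The test on \<open>p\<close> and \<open>q\<close> only makes the function total; \<open>m_rec\<close> below is the recursion in
  the range of parameters of the puzzle.\<close>

function m :: "int \<Rightarrow> int \<Rightarrow> int \<Rightarrow> nat" where
  "m p q n = (if n \<le> 0 \<or> p < 1 \<or> q < 0 then 0 else m p q (n - p) + m p q (n - p - q) + 1)"
  by auto
termination
  by (relation "measure (\<lambda>(p, q, n). nat n)") auto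

declare m.simps [simp del]

lemma m_nonpos: "n \<le> 0 \<Longrightarrow> m p q n = 0"
  by (simp add: m.simps)

lemma m_rec: "p \<ge> 1 \<Longrightarrow> q \<ge> 0 \<Longrightarrow> n > 0 \<Longrightarrow> m p q n = m p q (n - p) + m p q (n - p - q) + 1"
  by (subst m.simps) auto

end

theory Submission
  imports Defs
begin

text \<open>The recursive solution moves \<open>\<Delta>\<^bsub>n-p\<^esub>\<close> to the third peg, performs the move with \<open>k = n\<close>
  and moves \<open>\<Delta>\<^bsub>n-p-q\<^esub>\<close> on top. For its optimality one looks at the first and at the last move
  of a disk \<open>\<ge> n\<close>. Since larger disks may make detours in the two phases around these moves, the
  induction runs over two statements that allow such detours: \<open>unstacking\<close> bounds the first phase,
  where the disks that follow the tower lie below it at the start, and \<open>restacking\<close> the last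
  one, where they lie below it at the end.

  The delicate case of \<open>restacking a\<close> is a shortcut that carries the whole tower \<open>\<Delta>\<^bsub>a\<^esub>\<close> along
  when the disk \<open>a + p\<close> moves. Let \<open>l\<close> be the largest disk that moves and \<open>c = l - p \<ge> a\<close>. Between
  the last two moves of \<open>l\<close> the tower \<open>\<Delta>\<^bsub>c\<^esub>\<close> is rebuilt on one peg while \<open>\<Delta>\<^bsub>c-q\<^esub>\<close> starts off the
  peg of \<open>l\<close>; prefixing the optimal transfer of \<open>\<Delta>\<^bsub>c-q\<^esub>\<close> yields an instance of \<open>unstacking c\<close>. As
  many moves as were prefixed are needed after the last move of \<open>l\<close>, so the shortcut costs
  more than \<open>m\<^sub>c\<close> moves.\<close>

section \<open>States as assignments of pegs to disks\<close>

definition peg_of :: "state \<Rightarrow> int \<Rightarrow> peg" where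
  "peg_of s d = (THE P. d \<in> s P)"

definition relocate :: "int \<Rightarrow> int \<Rightarrow> peg \<Rightarrow> state \<Rightarrow> state" where
  "relocate a b Z s = (\<lambda>P. if P = Z then s P \<union> Delta a b else s P - Delta a b)"

text \<open>The third peg when the arguments differ; for equal arguments an arbitrary peg different
  from them.\<close>

definition other :: "peg \<Rightarrow> peg \<Rightarrow> peg" where
  "other X Y = (if X \<noteq> PegA \<and> Y \<noteq> PegA then PegA else if X \<noteq> PegB \<and> Y \<noteq> PegB then PegB else PegC)"

lemma other_eq: "distinct [X, Y, Z] \<Longrightarrow> Y = other X Z"
  by (cases X; cases Y; cases Z) (auto simp: other_def)

lemma other_neq: "X \<noteq> Y \<Longrightarrow> other X Y \<noteq> X \<and> other X Y \<noteq> Y"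
  by (cases X; cases Y) (auto simp: other_def)

text \<open>The union condition gives a peg for each disk and disjointness makes it unique, so the
  definite description in \<open>peg_of\<close> is meaningful for the disks of a valid
  state.\<close>

lemma mem_state_iff:
  assumes "is_state n s" "1 \<le> d" "d \<le> n"
  shows "d \<in> s P \<longleftrightarrow> peg_of s d = P"
proof -
  have "d \<in> s PegA \<union> s PegB \<union> s PegC"
    using assms by (auto simp: is_state_def Delta_def)
  then obtain Q where Q: "d \<in> s Q" by auto
  have uniq: "R = Q" if "d \<in> s R" for R
    using assms(1) that Q unfolding is_state_def by blast
  have "peg_of s d = Q"
    unfolding peg_of_def using Q uniq by (rule the_equality)
  then show ?thesis using Q uniq by blast
qed

lemma state_range: "is_state n s \<Longrightarrow> d \<in> s P \<Longrightarrow> 1 \<le> d \<and> d \<le> n"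
  by (cases P) (auto simp: is_state_def Delta_def)

lemma state_eqI:
  assumes "is_state n s" "is_state n t"
    and "\<And>d. 1 \<le> d \<Longrightarrow> d \<le> n \<Longrightarrow> peg_of s d = peg_of t d"
  shows "s = t"
proof (rule ext)
  fix P
  show "s P = t P"
    using assms state_range[of n] mem_state_iff[of n] by (metis set_eqI)
qed

lemma is_state_relocate:
  assumes "is_state n s" "b \<le> n"
  shows "is_state n (relocate a b Z s)"
  using assms unfolding is_state_def relocate_def
  by (cases Z) (auto simp: Delta_def)

lemma peg_of_relocate:
  assumes "is_state n s" "b \<le> n" "1 \<le> d" "d \<le> n"
  shows "peg_of (relocate a b Z s) d = (if a \<le> d \<and> d \<le> b then Z else peg_of s d)"
proof -
  let ?P = "if a \<le> d \<and> d \<le> b then Z else peg_of s d"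
  have "d \<in> relocate a b Z s ?P"
    using assms mem_state_iff[OF assms(1,3,4)] by (auto simp: relocate_def Delta_def)
  then show ?thesis
    using mem_state_iff[OF is_state_relocate[OF assms(1,2)] assms(3,4)] by blast
qed

text \<open>The disk \<open>k\<close> of a move, and junk for a pair of states that agree.\<close>

definition top_disk :: "int \<Rightarrow> state \<times> state \<Rightarrow> int" where
  "top_disk n mv = Max {d \<in> {1..n}. peg_of (fst mv) d \<noteq> peg_of (snd mv) d}"

section \<open>Moves expressed through peg positions\<close>

locale hanoi =
  fixes p q n :: int
  assumes p_pos: "1 \<le> p" and q_nonneg: "0 \<le> q"
begin

text \<open>A move without the auxiliary sets: X' and Y' can be recovered as the disks above k on X
  and Y, and Z holds only larger disks because every disk up to k is on X or Y. A nonpositive lower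
  end of the relocated block is cut off at 1 by \<open>Delta\<close>.\<close>

definition step :: "int \<Rightarrow> peg \<Rightarrow> peg \<Rightarrow> peg \<Rightarrow> state \<Rightarrow> state \<Rightarrow> bool" where
  "step k X Y Z s t \<longleftrightarrow> is_state n s \<and> 1 \<le> k \<and> k \<le> n \<and> distinct [X, Y, Z] \<and>
     (\<forall>d. 1 \<le> d \<and> k - p < d \<and> d \<le> k \<longrightarrow> peg_of s d = X) \<and>
     (\<forall>d. 1 \<le> d \<and> d \<le> k - p \<longrightarrow> peg_of s d = Y) \<and>
     t = relocate (k - p - q + 1) k Z s"

lemma pq_move_step:
  assumes "pq_move p q n s t"
  obtains k X Y Z where "step k X Y Z s t"
proof -
  from assms obtain k X Y Z X' Y' where
    st: "is_state n s" and k: "k \<in> Delta 1 n" and dis: "distinct [X, Y, Z]"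
    and big: "\<forall>d \<in> X' \<union> Y' \<union> s Z. k < d"
    and sX: "s X = Delta (k - p + 1) k \<union> X'"
    and sY: "s Y = Delta 1 (k - p) \<union> Y'"
    and tX: "t X = X'"
    and tY: "t Y = Delta 1 (k - p - q) \<union> Y'"
    and tZ: "t Z = Delta (k - p + 1 - q) k \<union> s Z"
    unfolding pq_move_def by blast
  have above: "\<And>d. d \<in> X' \<Longrightarrow> k < d" "\<And>d. d \<in> Y' \<Longrightarrow> k < d" using big by auto
  have kn: "1 \<le> k" "k \<le> n" using k by (auto simp: Delta_def)
  have a: "peg_of s d = X" if "1 \<le> d" "k - p < d" "d \<le> k" for d
    using mem_state_iff[OF st, of d X] sX that kn by (auto simp: Delta_def)
  have b: "peg_of s d = Y" if "1 \<le> d" "d \<le> k - p" for d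
    using mem_state_iff[OF st, of d Y] sY that kn p_pos by (auto simp: Delta_def)
  have "t = relocate (k - p - q + 1) k Z s"
  proof (rule ext)
    fix P
    have "P = X \<or> P = Y \<or> P = Z"
      using dis by (cases P; cases X; cases Y; cases Z) auto
    \<comment> \<open>As q >= 0, the relocated block contains the whole block of p disks on X, so
      only disks above k remain there.\<close>
    moreover have "t X = relocate (k - p - q + 1) k Z s X"
      using dis above(1) tX sX q_nonneg by (force simp: relocate_def Delta_def)
    moreover have "t Y = relocate (k - p - q + 1) k Z s Y"
      using dis above(2) tY sY p_pos q_nonneg by (force simp: relocate_def Delta_def)
    moreover have "t Z = relocate (k - p - q + 1) k Z s Z"
      by (simp add: tZ relocate_def Un_commute algebra_simps)
    ultimately show "t P = relocate (k - p - q + 1) k Z s P" by (elim disjE) simp_all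
  qed
  then have "step k X Y Z s t"
    unfolding step_def using st kn dis a b by blast
  then show thesis by (rule that)
qed

lemma step_pq_move:
  assumes "step k X Y Z s t"
  shows "pq_move p q n s t"
proof -
  have st: "is_state n s" and k: "1 \<le> k" "k \<le> n" and dis: "distinct [X, Y, Z]"
    and sX: "\<And>d. 1 \<le> d \<Longrightarrow> k - p < d \<Longrightarrow> d \<le> k \<Longrightarrow> peg_of s d = X"
    and sY: "\<And>d. 1 \<le> d \<Longrightarrow> d \<le> k - p \<Longrightarrow> peg_of s d = Y"
    and t: "t = relocate (k - p - q + 1) k Z s"
    using assms unfolding step_def by auto
  define X' where "X' = {d \<in> s X. k < d}"
  define Y' where "Y' = {d \<in> s Y. k < d}"
  have mem: "d \<in> s P \<longleftrightarrow> 1 \<le> d \<and> d \<le> n \<and> peg_of s d = P" for d P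
    using mem_state_iff[OF st] state_range[OF st] by blast
  have eqX: "s X = Delta (k - p + 1) k \<union> X'"
    using sX sY dis k p_pos by (auto simp: X'_def Y'_def mem Delta_def; metis not_le)
  have eqY: "s Y = Delta 1 (k - p) \<union> Y'"
    using sX sY dis k p_pos by (auto simp: X'_def Y'_def mem Delta_def; metis not_le)
  have Z: "\<forall>d \<in> s Z. k < d"
    using sX sY dis k p_pos by (auto simp: mem; metis not_le)
  have tX: "t X = X'"
  proof -
    have "t X = s X - Delta (k - p - q + 1) k" using dis by (simp add: t relocate_def)
    also have "\<dots> = X'" by (subst eqX) (use q_nonneg in \<open>auto simp: X'_def Delta_def\<close>)
    finally show ?thesis .
  qed
  have tY: "t Y = Delta 1 (k - p - q) \<union> Y'"
  proof -
    have "t Y = s Y - Delta (k - p - q + 1) k" using dis by (simp add: t relocate_def)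
    also have "\<dots> = Delta 1 (k - p - q) \<union> Y'"
      by (subst eqY) (use q_nonneg p_pos in \<open>auto simp: Y'_def Delta_def\<close>)
    finally show ?thesis .
  qed
  have tZ: "t Z = Delta (k - p + 1 - q) k \<union> s Z"
    by (auto simp: t relocate_def Delta_def)
  have above: "\<forall>d \<in> X' \<union> Y' \<union> s Z. k < d"
    using Z by (auto simp: X'_def Y'_def)
  have "k \<in> Delta 1 n" using k by (simp add: Delta_def)
  then show ?thesis
    unfolding pq_move_def using st dis above eqX eqY tX tY tZ by blast
qed

lemma step_state: "step k X Y Z s t \<Longrightarrow> is_state n s \<and> is_state n t"
  by (auto simp: step_def is_state_relocate)

lemma step_source:
  "step k X Y Z s t \<Longrightarrow> 1 \<le> d \<Longrightarrow> d \<le> k \<Longrightarrow> peg_of s d = (if k - p < d then X else Y)"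
  by (auto simp: step_def)

lemma step_target:
  "step k X Y Z s t \<Longrightarrow> 1 \<le> d \<Longrightarrow> d \<le> n \<Longrightarrow>
    peg_of t d = (if d \<le> k - p - q then Y else if d \<le> k then Z else peg_of s d)"
  using p_pos q_nonneg by (auto simp: step_def peg_of_relocate)

lemma step_range: "step k X Y Z s t \<Longrightarrow> 1 \<le> k \<and> k \<le> n \<and> distinct [X, Y, Z]"
  by (simp add: step_def)

text \<open>Disk k goes from X to Z and nothing above it moves, so k can be read off the pair of
  states.\<close>

lemma top_disk_step:
  assumes "step k X Y Z s t"
  shows "top_disk n (s, t) = k"
  unfolding top_disk_def
proof (rule Max_eqI)
  show "finite {d \<in> {1..n}. peg_of (fst (s, t)) d \<noteq> peg_of (snd (s, t)) d}"
    by (rule finite_subset[of _ "{1..n}"]) auto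
  show "y \<le> k" if "y \<in> {d \<in> {1..n}. peg_of (fst (s, t)) d \<noteq> peg_of (snd (s, t)) d}" for y
    using that step_target[OF assms, of y] p_pos q_nonneg by (auto split: if_splits)
  show "k \<in> {d \<in> {1..n}. peg_of (fst (s, t)) d \<noteq> peg_of (snd (s, t)) d}"
    using step_target[OF assms, of k] step_source[OF assms, of k] step_range[OF assms]
      p_pos q_nonneg by auto
qed

section \<open>Paths and their first and last moves of large disks\<close>

abbreviation path :: "state \<Rightarrow> (state \<times> state) list \<Rightarrow> state \<Rightarrow> bool" where
  "path \<equiv> move_seq p q n"

abbreviation lead :: "state \<times> state \<Rightarrow> int" where
  "lead \<equiv> top_disk n"

inductive_cases path_ConsE: "path s (mv # ms) t"

lemma path_append: "path s ms t \<Longrightarrow> path t ms' u \<Longrightarrow> path s (ms @ ms') u"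
  by (induction rule: move_seq.induct) (auto intro: move_seq.intros)

lemma path_appendE:
  assumes "path s (ms @ ms') u"
  obtains t where "path s ms t" "path t ms' u"
proof -
  have "\<exists>t. path s ms t \<and> path t ms' u"
    using assms
  proof (induction ms arbitrary: s)
    case Nil
    then show ?case by (auto intro: move_seq.intros)
  next
    case (Cons mv ms)
    from Cons.prems obtain r where r: "mv = (s, r)" "pq_move p q n s r" "path r (ms @ ms') u"
      by (auto elim: path_ConsE)
    from Cons.IH[OF r(3)] show ?case using r by (auto intro: move_seq.intros)
  qed
  then show thesis using that by blast
qed

lemma path_state:
  assumes "path s ms t" "is_state n s"
  shows "is_state n t"
  using assms
proof (induction rule: move_seq.induct)
  case (Cons s t ms u)
  from Cons.hyps(1) obtain k X Y Z where "step k X Y Z s t" by (rule pq_move_step)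
  then show ?case using Cons.IH step_state by blast
qed simp

lemma path_lead_le:
  assumes "path s ms t" "mv \<in> set ms"
  shows "lead mv \<le> n"
  using assms
proof (induction rule: move_seq.induct)
  case (Cons s t ms u)
  from Cons.hyps(1) obtain k X Y Z where st: "step k X Y Z s t" by (rule pq_move_step)
  show ?case using Cons top_disk_step[OF st] step_range[OF st] by auto
qed simp

lemma path_fixed:
  assumes "path s ms t" "\<forall>mv \<in> set ms. lead mv < b" "1 \<le> d" "b \<le> d" "d \<le> n"
  shows "peg_of t d = peg_of s d"
  using assms
proof (induction rule: move_seq.induct)
  case (Cons s t ms u)
  from Cons.hyps(1) obtain k X Y Z where st: "step k X Y Z s t" by (rule pq_move_step)
  have "k < b" using Cons.prems(1) top_disk_step[OF st] by auto
  then have "peg_of t d = peg_of s d"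
    using step_target[OF st, of d] Cons.prems p_pos q_nonneg by auto
  then show ?case using Cons by simp
qed simp

lemma path_splitE:
  assumes "path s (ms1 @ mv # ms2) t"
  obtains s1 t1 k X Y Z where "mv = (s1, t1)" "path s ms1 s1" "path t1 ms2 t"
    "step k X Y Z s1 t1" "lead mv = k"
proof -
  from assms obtain s1 where 1: "path s ms1 s1" "path s1 (mv # ms2) t" by (rule path_appendE)
  from 1(2) obtain t1 where 2: "mv = (s1, t1)" "pq_move p q n s1 t1" "path t1 ms2 t"
    by (auto elim: path_ConsE)
  from 2(2) obtain k X Y Z where "step k X Y Z s1 t1" by (rule pq_move_step)
  then show thesis using that 1 2 top_disk_step by blast
qed

text \<open>Cutting at the first large move leaves a prefix in which, by \<open>path_fixed\<close>,
  no disk from b on has moved; \<open>path_lastE\<close> does the same for the suffix.\<close>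

lemma path_firstE:
  assumes "path s ms t" "\<exists>mv \<in> set ms. b \<le> lead mv"
  obtains ms1 s1 t1 ms2 k X Y Z where "ms = ms1 @ (s1, t1) # ms2"
    "path s ms1 s1" "path t1 ms2 t" "step k X Y Z s1 t1" "b \<le> k" "\<forall>mv \<in> set ms1. lead mv < b"
    "lead (s1, t1) = k"
proof -
  from split_list_first_prop[OF assms(2)] obtain ms1 mv ms2 where
    ms: "ms = ms1 @ mv # ms2" "b \<le> lead mv" "\<forall>mv \<in> set ms1. \<not> b \<le> lead mv" by blast
  from assms(1) show thesis unfolding ms(1)
    by (rule path_splitE) (use ms that in \<open>auto simp: not_le\<close>)
qed

lemma path_lastE:
  assumes "path s ms t" "\<exists>mv \<in> set ms. b \<le> lead mv"
  obtains ms1 s1 t1 ms2 k X Y Z where "ms = ms1 @ (s1, t1) # ms2"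
    "path s ms1 s1" "path t1 ms2 t" "step k X Y Z s1 t1" "b \<le> k" "\<forall>mv \<in> set ms2. lead mv < b"
    "lead (s1, t1) = k"
proof -
  from split_list_last_prop[OF assms(2)] obtain ms1 mv ms2 where
    ms: "ms = ms1 @ mv # ms2" "b \<le> lead mv" "\<forall>mv \<in> set ms2. \<not> b \<le> lead mv" by blast
  from assms(1) show thesis unfolding ms(1)
    by (rule path_splitE) (use ms that in \<open>auto simp: not_le\<close>)
qed

section \<open>The canonical recursive solution and its length\<close>

lemma m_mono: "a \<le> b \<Longrightarrow> m p q a \<le> m p q b"
proof (induction "nat b" arbitrary: a b rule: less_induct)
  case less
  show ?case
  proof (cases "0 < a")
    case True
    then have b: "0 < b" using less.prems by simp
    have "m p q (a - p) \<le> m p q (b - p)" "m p q (a - p - q) \<le> m p q (b - p - q)"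
      using less b p_pos q_nonneg by auto
    then show ?thesis using True b p_pos q_nonneg by (simp add: m_rec)
  qed (simp add: m_nonpos)
qed

text \<open>Moves are pairs of states, so the full state is an argument. The intermediate states are
  written down directly with \<open>relocate\<close>; that moves really connect them is shown in
  \<open>canon_path\<close>.\<close>

function canon :: "int \<Rightarrow> peg \<Rightarrow> peg \<Rightarrow> state \<Rightarrow> (state \<times> state) list" where
  "canon a X Y s = (if a \<le> 0 then [] else
     (let Z = other X Y; s1 = relocate 1 (a - p) Z s; s2 = relocate (a - p - q + 1) a Y s1
      in canon (a - p) X Z s @ (s1, s2) # canon (a - p - q) Z Y s2))"
  by pat_completeness auto
termination
  by (relation "measure (\<lambda>(a, X, Y, s). nat a)") (use p_pos q_nonneg in auto)

declare canon.simps [simp del]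

lemma canon_nonpos: "a \<le> 0 \<Longrightarrow> canon a X Y s = []"
  by (simp add: canon.simps)

text \<open>Disks above a may lie anywhere, since a move with k <= a imposes nothing on
  them.\<close>

lemma canon_path:
  assumes "is_state n s" "X \<noteq> Y" "a \<le> n" "\<And>d. 1 \<le> d \<Longrightarrow> d \<le> a \<Longrightarrow> peg_of s d = X"
  shows "path s (canon a X Y s) (relocate 1 a Y s) \<and> length (canon a X Y s) = m p q a \<and>
    (\<forall>mv \<in> set (canon a X Y s). lead mv \<le> a)"
  using assms
proof (induction "nat a" arbitrary: a X Y s rule: less_induct)
  case less
  show ?case
  proof (cases "a \<le> 0")
    case True
    have "relocate 1 a Y s = s"
      using True by (auto simp: relocate_def Delta_def fun_eq_iff)
    then show ?thesis using True by (simp add: canon_nonpos m_nonpos move_seq.Nil)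
  next
    case False
    define Z where "Z = other X Y"
    define s1 where "s1 = relocate 1 (a - p) Z s"
    define s2 where "s2 = relocate (a - p - q + 1) a Y s1"
    have Z: "Z \<noteq> X" "Z \<noteq> Y" using other_neq[OF less.prems(2)] by (auto simp: Z_def)
    have st1: "is_state n s1" unfolding s1_def
      using less.prems p_pos by (intro is_state_relocate) auto
    have peg1: "peg_of s1 d = (if d \<le> a - p then Z else peg_of s d)" if "1 \<le> d" "d \<le> n" for d
      unfolding s1_def using that less.prems p_pos by (subst peg_of_relocate) auto
    have st2: "is_state n s2" unfolding s2_def
      using st1 less.prems by (intro is_state_relocate) auto
    have peg2: "peg_of s2 d = (if d \<le> a - p - q then Z else if d \<le> a then Y else peg_of s d)"
      if "1 \<le> d" "d \<le> n" for d
      unfolding s2_def using that less.prems p_pos q_nonneg st1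
      by (subst peg_of_relocate) (auto simp: peg1)
    have step: "step a X Z Y s1 s2"
      unfolding step_def using st1 False less.prems Z p_pos by (auto simp: peg1 s2_def)
    have 1: "path s (canon (a - p) X Z s) s1 \<and> length (canon (a - p) X Z s) = m p q (a - p) \<and>
      (\<forall>mv \<in> set (canon (a - p) X Z s). lead mv \<le> a - p)"
      unfolding s1_def using False p_pos less.prems Z by (intro less.hyps) auto
    have 2: "path s2 (canon (a - p - q) Z Y s2) (relocate 1 (a - p - q) Y s2) \<and>
      length (canon (a - p - q) Z Y s2) = m p q (a - p - q) \<and>
      (\<forall>mv \<in> set (canon (a - p - q) Z Y s2). lead mv \<le> a - p - q)"
      using False p_pos q_nonneg less.prems Z st2 by (intro less.hyps) (auto simp: peg2)
    \<comment> \<open>The detour over Z is overwritten: the middle move already brought the disks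
      above a - p - q up to a to Y, and the last phase brings the rest.\<close>
    have fin: "relocate 1 (a - p - q) Y s2 = relocate 1 a Y s"
      using less.prems p_pos q_nonneg st2
      by (intro state_eqI[of n]) (auto simp: is_state_relocate peg_of_relocate peg2)
    have eq: "canon a X Y s = canon (a - p) X Z s @ (s1, s2) # canon (a - p - q) Z Y s2"
      using False by (subst canon.simps) (simp add: Let_def Z_def s1_def s2_def)
    have "path s1 ((s1, s2) # canon (a - p - q) Z Y s2) (relocate 1 a Y s)"
      using step_pq_move[OF step] 2 fin by (auto intro: move_seq.intros)
    then have "path s (canon a X Y s) (relocate 1 a Y s)"
      unfolding eq using 1 by (blast intro: path_append)
    moreover have "length (canon a X Y s) = m p q a"
      unfolding eq using 1 2 False p_pos q_nonneg by (simp add: m_rec)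
    moreover have "\<forall>mv \<in> set (canon a X Y s). lead mv \<le> a"
      unfolding eq using 1 2 top_disk_step[OF step] p_pos q_nonneg by fastforce
    ultimately show ?thesis by blast
  qed
qed

text \<open>The recursion read backwards. The state before the middle move is forced: up to a by the
  requirements of that move, above a because nothing there has changed.\<close>

lemma canon_eqI:
  assumes "0 < a" "is_state n s" "X \<noteq> Y" "\<And>d. 1 \<le> d \<Longrightarrow> d \<le> a \<Longrightarrow> peg_of s d = X"
    and step: "step a X Z Y s1 t1"
    and fixed: "\<And>d. a < d \<Longrightarrow> d \<le> n \<Longrightarrow> peg_of s1 d = peg_of s d"
    and ms: "ms1 = canon (a - p) X Z s" "ms2 = canon (a - p - q) Z Y t1"
  shows "ms1 @ (s1, t1) # ms2 = canon a X Y s"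
proof -
  have Z: "Z = other X Y" using step_range[OF step] by (intro other_eq) auto
  have an: "a \<le> n" using step_range[OF step] by simp
  have s1: "s1 = relocate 1 (a - p) Z s"
  proof (rule state_eqI[of n])
    show "is_state n s1" using step_state[OF step] by simp
    show "is_state n (relocate 1 (a - p) Z s)" using assms an p_pos by (intro is_state_relocate) auto
    show "peg_of s1 d = peg_of (relocate 1 (a - p) Z s) d" if "1 \<le> d" "d \<le> n" for d
      using that an assms(2,4) p_pos fixed[of d] step_source[OF step, of d]
      by (cases "d \<le> a") (auto simp: peg_of_relocate)
  qed
  have t1: "t1 = relocate (a - p - q + 1) a Y s1"
    using step by (simp add: step_def)
  show ?thesis
    using assms(1) by (subst canon.simps) (simp add: Let_def ms s1[symmetric] t1[symmetric] Z[symmetric])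
qed

section \<open>Optimality statements for the two phases around a large move\<close>

definition optimal :: "int \<Rightarrow> peg \<Rightarrow> peg \<Rightarrow> state \<Rightarrow> (state \<times> state) list \<Rightarrow> bool" where
  "optimal a X Y s ms \<longleftrightarrow> m p q a \<le> length ms \<and> (length ms = m p q a \<longrightarrow> ms = canon a X Y s)"

lemma optimal_nonpos: "a \<le> 0 \<Longrightarrow> optimal a X Y s ms"
  by (simp add: optimal_def m_nonpos canon_nonpos)

text \<open>The bound \<open>d \<le> n\<close> is not redundant here: \<open>c + p\<close> may exceed \<open>n\<close>, and the theorem is
  the case \<open>c = n\<close>.\<close>

definition unstacking :: "int \<Rightarrow> bool" where
  "unstacking c \<longleftrightarrow> (\<forall>s ms t X Y. path s ms t \<longrightarrow> is_state n s \<longrightarrow> X \<noteq> Y \<longrightarrow> c \<le> n \<longrightarrow>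
     (\<forall>d. 1 \<le> d \<and> d \<le> n \<and> d \<le> c + p \<longrightarrow> peg_of s d = X) \<longrightarrow>
     (\<forall>d. 1 \<le> d \<and> d \<le> n \<and> d \<le> c + p \<longrightarrow> peg_of t d = (if d \<le> c then Y else X)) \<longrightarrow>
     (\<forall>mv \<in> set ms. lead mv < c + p) \<longrightarrow> optimal c X Y s ms)"

text \<open>The starting position is the one left by a move with k = a + p + q onto Y, whence the
  offset p + q.\<close>

definition restacking :: "int \<Rightarrow> bool" where
  "restacking a \<longleftrightarrow> (\<forall>s ms t X Y. path s ms t \<longrightarrow> is_state n s \<longrightarrow> X \<noteq> Y \<longrightarrow> a + p + q \<le> n \<longrightarrow>
     (\<forall>d. 1 \<le> d \<and> d \<le> a + p + q \<longrightarrow> peg_of s d = (if d \<le> a then X else Y)) \<longrightarrow>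
     (\<forall>d. 1 \<le> d \<and> d \<le> a + p + q \<longrightarrow> peg_of t d = Y) \<longrightarrow>
     (\<forall>mv \<in> set ms. lead mv < a + p + q) \<longrightarrow> optimal a X Y s ms)"

lemma unstackingD:
  assumes "unstacking c" "path s ms t" "is_state n s" "X \<noteq> Y" "c \<le> n"
    "\<And>d. 1 \<le> d \<Longrightarrow> d \<le> n \<Longrightarrow> d \<le> c + p \<Longrightarrow> peg_of s d = X"
    "\<And>d. 1 \<le> d \<Longrightarrow> d \<le> n \<Longrightarrow> d \<le> c + p \<Longrightarrow> peg_of t d = (if d \<le> c then Y else X)"
    "\<And>mv. mv \<in> set ms \<Longrightarrow> lead mv < c + p"
  shows "optimal c X Y s ms"
  using assms unfolding unstacking_def by blast

lemma restackingD:
  assumes "restacking a" "path s ms t" "is_state n s" "X \<noteq> Y" "a + p + q \<le> n"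
    "\<And>d. 1 \<le> d \<Longrightarrow> d \<le> a + p + q \<Longrightarrow> peg_of s d = (if d \<le> a then X else Y)"
    "\<And>d. 1 \<le> d \<Longrightarrow> d \<le> a + p + q \<Longrightarrow> peg_of t d = Y"
    "\<And>mv. mv \<in> set ms \<Longrightarrow> lead mv < a + p + q"
  shows "optimal a X Y s ms"
  using assms unfolding restacking_def by blast

lemma restacking_tail:
  assumes "restacking (k - p - q)" "step k X Y Z s t" "path t ms u"
    "\<And>d. 1 \<le> d \<Longrightarrow> d \<le> k \<Longrightarrow> peg_of u d = Z" "\<And>mv. mv \<in> set ms \<Longrightarrow> lead mv < k"
  shows "optimal (k - p - q) Y Z t ms"
  using assms(1,3)
proof (rule restackingD)
  note st = assms(2)
  show "is_state n t" "Y \<noteq> Z" "k - p - q + p + q \<le> n"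
    using step_state[OF st] step_range[OF st] by auto
  show "peg_of t d = (if d \<le> k - p - q then Y else Z)" if "1 \<le> d" "d \<le> k - p - q + p + q" for d
    using step_target[OF st, of d] step_range[OF st] that by auto
qed (use assms in auto)

text \<open>Just before the move, the disks up to k - p are on Y and the next p are still on X,
  which is the final position in \<open>unstacking (k - p)\<close>.\<close>

lemma unstacking_head:
  assumes "unstacking (k - p)" "step k X Y Z s1 t1" "path s ms s1" "is_state n s"
    "\<And>d. 1 \<le> d \<Longrightarrow> d \<le> k \<Longrightarrow> peg_of s d = X" "\<And>mv. mv \<in> set ms \<Longrightarrow> lead mv < k"
  shows "optimal (k - p) X Y s ms"
  using assms(1,3,4)
proof (rule unstackingD)
  note st = assms(2)
  show "X \<noteq> Y" "k - p \<le> n" using step_range[OF st] p_pos by auto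
  show "peg_of s1 d = (if d \<le> k - p then Y else X)" if "1 \<le> d" "d \<le> k - p + p" for d
    using step_source[OF st, of d] that by auto
qed (use assms in auto)

text \<open>The lengths add up to the recursion for m. Equality forces equality in both phases, so
  uniqueness is inherited as well.\<close>

lemma optimal_single:
  assumes "0 < a" "is_state n s" "\<And>d. 1 \<le> d \<Longrightarrow> d \<le> a \<Longrightarrow> peg_of s d = X"
    and step: "step a X Z Y s1 t1" and path: "path s ms1 s1"
    and tops: "\<forall>mv \<in> set ms1. lead mv < a"
    and opt: "optimal (a - p) X Z s ms1" "optimal (a - p - q) Z Y t1 ms2"
  shows "optimal a X Y s (ms1 @ (s1, t1) # ms2)"
proof -
  have m: "m p q a = m p q (a - p) + m p q (a - p - q) + 1"
    using assms(1) p_pos q_nonneg by (simp add: m_rec)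
  have fixed: "peg_of s1 d = peg_of s d" if "a < d" "d \<le> n" for d
    using path_fixed[OF path tops] that assms(1) by auto
  have "X \<noteq> Y" using step_range[OF step] by auto
  then have "ms1 @ (s1, t1) # ms2 = canon a X Y s"
    if "ms1 = canon (a - p) X Z s" "ms2 = canon (a - p - q) Z Y t1"
    using canon_eqI[OF assms(1,2) _ assms(3) step fixed that] by blast
  then show ?thesis using opt unfolding optimal_def m by auto
qed

text \<open>With two large moves the outer phases already cost \<open>m p q a - 1\<close> by
  monotonicity, so the length exceeds the minimum and the uniqueness clause is vacuous.\<close>

lemma optimal_double:
  assumes "0 < a" "a \<le> k" "a \<le> k2"
    and "optimal (k - p) X1 Y1 s1 ms1" "optimal (k2 - p - q) X2 Y2 s2 ms3"
  shows "optimal a X Y s (ms1 @ mv # ms2 @ mv' # ms3)"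
proof -
  have "m p q a = m p q (a - p) + m p q (a - p - q) + 1"
    using assms(1) p_pos q_nonneg by (simp add: m_rec)
  moreover have "m p q (a - p) \<le> m p q (k - p)" "m p q (a - p - q) \<le> m p q (k2 - p - q)"
    using assms by (auto intro: m_mono)
  ultimately show ?thesis using assms(4,5) unfolding optimal_def by auto
qed

section \<open>The mutual induction\<close>

lemma unstacking_step:
  assumes un: "\<And>c'. c' < c \<Longrightarrow> unstacking c'" and re: "\<And>a. a < c - q \<Longrightarrow> restacking a"
  shows "unstacking c"
  unfolding unstacking_def
proof (intro allI impI)
  fix s ms t X Y
  assume path: "path s ms t" and st: "is_state n s" and XY: "X \<noteq> Y" and cn: "c \<le> n"
    and s: "\<forall>d. 1 \<le> d \<and> d \<le> n \<and> d \<le> c + p \<longrightarrow> peg_of s d = X"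
    and t: "\<forall>d. 1 \<le> d \<and> d \<le> n \<and> d \<le> c + p \<longrightarrow> peg_of t d = (if d \<le> c then Y else X)"
    and tops: "\<forall>mv \<in> set ms. lead mv < c + p"
  show "optimal c X Y s ms"
  proof (cases "0 < c")
    case True
    \<comment> \<open>The last large move puts both k2 and c on Z2, because k2 - p < c. At the end c
      is on Y while the disks just above c are on X, so k2 > c is impossible.\<close>
    have tail: "k2 = c \<and> Z2 = Y \<and> optimal (c - p - q) Y2 Y t2 ms4"
      if st2: "step k2 X2 Y2 Z2 s2 t2" and "path t2 ms4 t" and k2: "c \<le> k2" "k2 < c + p"
        and tops4: "\<forall>mv \<in> set ms4. lead mv < c" for k2 X2 Y2 Z2 s2 t2 ms4
    proof -
      have k2n: "k2 \<le> n" using step_range[OF st2] by simp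
      have "peg_of t2 d = peg_of t d" if "c \<le> d" "d \<le> n" for d
        using path_fixed[OF \<open>path t2 ms4 t\<close> tops4, of d] that True by simp
      then have "peg_of t k2 = Z2" "peg_of t c = Z2"
        using step_target[OF st2, of k2] step_target[OF st2, of c] k2 k2n cn p_pos q_nonneg True
        by auto
      moreover have "peg_of t c = Y" "peg_of t k2 = (if k2 \<le> c then Y else X)"
        using t k2 k2n cn True p_pos by auto
      ultimately have "k2 = c" "Z2 = Y" using XY k2 by (auto split: if_splits)
      moreover have "optimal (c - p - q) Y2 Y t2 ms4"
        using re[of "c - p - q"] p_pos st2 \<open>path t2 ms4 t\<close> t cn tops4 \<open>k2 = c\<close> \<open>Z2 = Y\<close>
        by (intro restacking_tail) auto
      ultimately show ?thesis by blast
    qed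
    have ex: "\<exists>mv \<in> set ms. c \<le> lead mv"
    proof (rule ccontr)
      assume "\<not> ?thesis"
      then have "peg_of t c = peg_of s c"
        using path_fixed[OF path, of c c] True cn by (auto simp: not_le)
      then show False using s t True cn XY p_pos by auto
    qed
    obtain ms1 s1 t1 ms2 k X1 Y1 Z1 where
      ms: "ms = ms1 @ (s1, t1) # ms2" and p1: "path s ms1 s1" and p2: "path t1 ms2 t"
      and st1: "step k X1 Y1 Z1 s1 t1" and k: "c \<le> k" and tops1: "\<forall>mv \<in> set ms1. lead mv < c"
      and topk: "lead (s1, t1) = k"
        by (rule path_firstE[OF path ex])
    have kp: "k < c + p" using tops ms topk by auto
    have kn: "k \<le> n" using step_range[OF st1] by simp
    \<comment> \<open>Disk k has not moved before, and k < c + p, so it still lies on X.\<close>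
    have "X1 = X"
      using path_fixed[OF p1 tops1, of k] step_source[OF st1, of k] s k kp kn True p_pos by auto
    then have st1: "step k X Y1 Z1 s1 t1" using st1 by simp
    have head: "optimal (k - p) X Y1 s ms1"
      using un[of "k - p"] kp st1 p1 st s kn k tops1
      by (intro unstacking_head[OF _ st1]) auto
    show ?thesis
    proof (cases "\<exists>mv \<in> set ms2. c \<le> lead mv")
      case False
      then have "\<forall>mv \<in> set ms2. lead mv < c" by (auto simp: not_le)
      from tail[OF st1 p2 k kp this]
      have 2: "k = c" "Z1 = Y" "optimal (c - p - q) Y1 Y t1 ms2" by auto
      show ?thesis unfolding ms
        using True st s cn st1 p1 tops1 head 2 p_pos by (intro optimal_single) auto
    next
      case ex: True
      obtain ms3 s2 t2 ms4 k2 X2 Y2 Z2 where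
        ms2: "ms2 = ms3 @ (s2, t2) # ms4" and "path t1 ms3 s2" and p4: "path t2 ms4 t"
        and st2: "step k2 X2 Y2 Z2 s2 t2" and k2: "c \<le> k2"
        and tops4: "\<forall>mv \<in> set ms4. lead mv < c" and topk2: "lead (s2, t2) = k2"
        by (rule path_lastE[OF p2 ex])
      have "k2 < c + p" using tops ms ms2 topk2 by auto
      from tail[OF st2 p4 k2 this tops4] have "optimal (k2 - p - q) Y2 Y t2 ms4" by simp
      then show ?thesis unfolding ms ms2 by (rule optimal_double[OF True k k2 head])
    qed
  qed (simp add: optimal_nonpos)
qed

lemma restacking_step:
  assumes un: "\<And>c. c < a + q \<Longrightarrow> unstacking c" and re: "\<And>a'. a' < a \<Longrightarrow> restacking a'"
  shows "restacking a"
  unfolding restacking_def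
proof (intro allI impI)
  fix s ms t X Y
  assume path: "path s ms t" and st: "is_state n s" and XY: "X \<noteq> Y" and an: "a + p + q \<le> n"
    and s: "\<forall>d. 1 \<le> d \<and> d \<le> a + p + q \<longrightarrow> peg_of s d = (if d \<le> a then X else Y)"
    and t: "\<forall>d. 1 \<le> d \<and> d \<le> a + p + q \<longrightarrow> peg_of t d = Y"
    and tops: "\<forall>mv \<in> set ms. lead mv < a + p + q"
  show "optimal a X Y s ms"
  proof (cases "0 < a")
    case True
    have tail: "Z2 = Y \<and> optimal (k2 - p - q) Y2 Y t2 ms4"
      if st2: "step k2 X2 Y2 Z2 s2 t2" and "path t2 ms4 t" and k2: "a \<le> k2" "k2 < a + p + q"
        and tops4: "\<forall>mv \<in> set ms4. lead mv < k2" for k2 X2 Y2 Z2 s2 t2 ms4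
    proof -
      have k2n: "k2 \<le> n" using step_range[OF st2] by simp
      have "peg_of t2 k2 = peg_of t k2"
        using path_fixed[OF \<open>path t2 ms4 t\<close> tops4, of k2] k2n k2 True by simp
      then have "Z2 = Y"
        using step_target[OF st2, of k2] k2 k2n p_pos q_nonneg True t by auto
      moreover have "optimal (k2 - p - q) Y2 Y t2 ms4"
        using re[of "k2 - p - q"] p_pos st2 \<open>path t2 ms4 t\<close> t k2 tops4 \<open>Z2 = Y\<close>
        by (intro restacking_tail) auto
      ultimately show ?thesis by blast
    qed
    have ex: "\<exists>mv \<in> set ms. a \<le> lead mv"
    proof (rule ccontr)
      assume "\<not> ?thesis"
      then have "peg_of t a = peg_of s a"
        using path_fixed[OF path, of a a] True an p_pos q_nonneg by (auto simp: not_le)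
      then show False using s t True an XY p_pos q_nonneg by auto
    qed
    obtain ms1 s1 t1 ms2 k X1 Y1 Z1 where
      ms: "ms = ms1 @ (s1, t1) # ms2" and p1: "path s ms1 s1" and p2: "path t1 ms2 t"
      and st1: "step k X1 Y1 Z1 s1 t1" and k: "a \<le> k" and tops1: "\<forall>mv \<in> set ms1. lead mv < a"
      and topk: "lead (s1, t1) = k"
        by (rule path_firstE[OF path ex])
    have kp: "k < a + p + q" using tops ms topk by auto
    have kn: "k \<le> n" using step_range[OF st1] by simp
    have s1: "peg_of s1 d = (if d \<le> a then X else Y)" if "a \<le> d" "d \<le> a + p + q" for d
      using path_fixed[OF p1 tops1, of d] s that True an by auto
    \<comment> \<open>Disk a is still on X and its p + q successors are on Y. For a < k < a + p,
      disks a and k would have to share the source peg; for k > a + p, disks a and a + 1 would have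
      to share the peg of the smaller disks.\<close>
    have "k = a \<or> k = a + p"
    proof (rule ccontr)
      assume "\<not> ?thesis"
      then consider "a < k" "k < a + p" | "a + p < k" using k by linarith
      then show False
      proof cases
        case 1
        then show False
          using s1[of a] s1[of k] step_source[OF st1, of a] step_source[OF st1, of k]
            kp True XY p_pos q_nonneg by auto
      next
        case 2
        then show False
          using s1[of a] s1[of "a + 1"] step_source[OF st1, of a] step_source[OF st1, of "a + 1"]
            kp True XY p_pos q_nonneg by auto
      qed
    qed
    then show ?thesis
    proof
      assume ka: "k = a"
      have "X1 = X"
        using s1[of a] step_source[OF st1, of a] p_pos q_nonneg True ka by auto
      then have st1: "step a X Y1 Z1 s1 t1" using st1 ka by simp
      have head: "optimal (a - p) X Y1 s ms1"
        using un[of "a - p"] p_pos q_nonneg st1 p1 st s tops1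
        by (intro unstacking_head[OF _ st1]) auto
      show ?thesis
      proof (cases "\<exists>mv \<in> set ms2. a \<le> lead mv")
        case False
        then have "\<forall>mv \<in> set ms2. lead mv < a" by (auto simp: not_le)
        from tail[OF st1 p2 _ _ this] have 2: "Z1 = Y" "optimal (a - p - q) Y1 Y t1 ms2"
          using p_pos q_nonneg by auto
        show ?thesis unfolding ms
          using True st s st1 p1 tops1 head 2 p_pos q_nonneg by (intro optimal_single) auto
      next
        case ex: True
        obtain ms3 s2 t2 ms4 k2 X2 Y2 Z2 where
          ms2: "ms2 = ms3 @ (s2, t2) # ms4" and "path t1 ms3 s2" and p4: "path t2 ms4 t"
          and st2: "step k2 X2 Y2 Z2 s2 t2" and k2: "a \<le> k2"
          and tops4: "\<forall>mv \<in> set ms4. lead mv < a" and topk2: "lead (s2, t2) = k2"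
        by (rule path_lastE[OF p2 ex])
        have "k2 < a + p + q" using tops ms ms2 topk2 by auto
        from tail[OF st2 p4 k2 this] have "optimal (k2 - p - q) Y2 Y t2 ms4"
          using tops4 k2 by fastforce
        then show ?thesis unfolding ms ms2 by (rule optimal_double[OF True order_refl k2 head])
      qed
    next
      assume ka: "k = a + p"
      \<comment> \<open>By maximality, every move led by at least l is led by exactly l.\<close>
      define l where "l = Max (lead ` set ms)"
      have fin: "finite (lead ` set ms)" and ne: "lead ` set ms \<noteq> {}" using ms by auto
      have l_ge: "lead mv \<le> l" if "mv \<in> set ms" for mv
        unfolding l_def using fin that by auto
      have l_in: "\<exists>mv \<in> set ms. l \<le> lead mv"
        using Max_in[OF fin ne] unfolding l_def by auto
      have la: "a + p \<le> l" using l_ge[of "(s1, t1)"] ms topk ka by simp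
      have lb: "l < a + p + q" using Max_in[OF fin ne] tops unfolding l_def by auto
      have l1: "1 \<le> l" and ln: "l \<le> n" using la lb an True p_pos by auto
      obtain ms5 s2 t2 ms4 k2 X2 Y2 Z2 where
        ms5: "ms = ms5 @ (s2, t2) # ms4" and p5: "path s ms5 s2" and p4: "path t2 ms4 t"
        and st2: "step k2 X2 Y2 Z2 s2 t2" and k2: "l \<le> k2"
        and tops4: "\<forall>mv \<in> set ms4. lead mv < l" and topk2: "lead (s2, t2) = k2"
        by (rule path_lastE[OF path l_in])
      have k2l: "k2 = l" using l_ge[of "(s2, t2)"] ms5 topk2 k2 by simp
      have st2: "step l X2 Y2 Z2 s2 t2" using st2 k2l by simp
      have tail2: "Z2 = Y" "optimal (l - p - q) Y2 Y t2 ms4"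
        using tail[OF st2 p4 _ lb tops4] la p_pos by auto
      have X2: "peg_of s2 l = X2" using step_source[OF st2, of l] l1 p_pos by simp
      \<comment> \<open>Disk l starts on Y, and its last move brings it to Y from a different peg,
        so it has moved before.\<close>
      have ex: "\<exists>mv \<in> set ms5. l \<le> lead mv"
      proof (rule ccontr)
        assume "\<not> ?thesis"
        then have "peg_of s2 l = peg_of s l"
          using path_fixed[OF p5, of l l] l1 ln by (auto simp: not_le)
        then show False
          using s la lb l1 X2 tail2(1) step_range[OF st2] p_pos by auto
      qed
      obtain ms6 s3 t3 ms7 k3 X3 Y3 Z3 where
        ms6: "ms5 = ms6 @ (s3, t3) # ms7" and "path s ms6 s3" and p7: "path t3 ms7 s2"
        and st3: "step k3 X3 Y3 Z3 s3 t3" and k3: "l \<le> k3"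
        and tops7: "\<forall>mv \<in> set ms7. lead mv < l" and topk3: "lead (s3, t3) = k3"
        by (rule path_lastE[OF p5 ex])
      have k3l: "k3 = l" using l_ge[of "(s3, t3)"] ms5 ms6 topk3 k3 by simp
      have st3: "step l X3 Y3 Z3 s3 t3" using st3 k3l by simp
      have Z3: "Z3 = X2"
        using path_fixed[OF p7 tops7, of l] X2 step_target[OF st3, of l] l1 ln p_pos q_nonneg
        by auto
      define c where "c = l - p"
      have ca: "a \<le> c" "c < a + q" using la lb by (auto simp: c_def)
      \<comment> \<open>A fictitious state: putting the disks that the move left on Y3 back on X2
        gathers all disks up to l = c + p there, as \<open>unstacking c\<close> demands.\<close>
      define s0 where "s0 = relocate 1 (c - q) X2 t3"
      have stt3: "is_state n t3" using step_state[OF st3] by simp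
      have cn: "c - q \<le> n" using ln p_pos q_nonneg by (simp add: c_def)
      have st0: "is_state n s0" unfolding s0_def using stt3 cn by (rule is_state_relocate)
      have peg0: "peg_of s0 d = (if d \<le> c - q then X2 else peg_of t3 d)" if "1 \<le> d" "d \<le> n" for d
        unfolding s0_def using that stt3 cn by (subst peg_of_relocate) auto
      have undo: "relocate 1 (c - q) Y3 s0 = t3"
      proof (rule state_eqI[of n])
        show "is_state n (relocate 1 (c - q) Y3 s0)" using st0 cn by (rule is_state_relocate)
        show "peg_of (relocate 1 (c - q) Y3 s0) d = peg_of t3 d" if "1 \<le> d" "d \<le> n" for d
          using that st0 cn step_target[OF st3, of d]
          by (subst peg_of_relocate) (auto simp: peg0 c_def)
      qed (rule stt3)
      have X2Y3: "X2 \<noteq> Y3" using step_range[OF st3] Z3 by auto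
      have "path s0 (canon (c - q) X2 Y3 s0) (relocate 1 (c - q) Y3 s0) \<and>
          length (canon (c - q) X2 Y3 s0) = m p q (c - q) \<and>
          (\<forall>mv \<in> set (canon (c - q) X2 Y3 s0). lead mv \<le> c - q)"
        using st0 X2Y3 cn by (rule canon_path) (use cn in \<open>auto simp: peg0\<close>)
      then have canon: "path s0 (canon (c - q) X2 Y3 s0) t3"
        and len: "length (canon (c - q) X2 Y3 s0) = m p q (c - q)"
        and tops0: "\<forall>mv \<in> set (canon (c - q) X2 Y3 s0). lead mv \<le> c - q"
        using undo by auto
      have "optimal c X2 Y2 s0 (canon (c - q) X2 Y3 s0 @ ms7)"
        using un[OF ca(2)] path_append[OF canon p7] st0
      proof (rule unstackingD)
        show "X2 \<noteq> Y2" "c \<le> n" using step_range[OF st2] ln p_pos by (auto simp: c_def)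
        show "peg_of s0 d = X2" if "1 \<le> d" "d \<le> n" "d \<le> c + p" for d
          using that step_target[OF st3, of d] Z3 by (auto simp: peg0 c_def)
        show "peg_of s2 d = (if d \<le> c then Y2 else X2)" if "1 \<le> d" "d \<le> n" "d \<le> c + p" for d
          using that step_source[OF st2, of d] by (auto simp: c_def)
        show "lead mv < c + p" if "mv \<in> set (canon (c - q) X2 Y3 s0 @ ms7)" for mv
          using that tops0 tops7 p_pos q_nonneg by (fastforce simp: c_def)
      qed
      then have "m p q c \<le> m p q (c - q) + length ms7" using len by (simp add: optimal_def)
      also have "m p q (c - q) \<le> length ms4"
        using tail2(2) by (simp add: optimal_def c_def)
      \<comment> \<open>The two moves of l come on top of the moves in \<open>ms7\<close> and
        \<open>ms4\<close>, which makes the inequality strict and uniqueness vacuous.\<close>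
      finally have "m p q a < length ms"
        using m_mono[OF ca(1)] ms5 ms6 by simp
      then show ?thesis by (simp add: optimal_def)
    qed
  qed (simp add: optimal_nonpos)
qed

text \<open>The shift by \<open>q\<close> makes the mutual induction well-founded: \<open>restacking a\<close> needs \<open>unstacking c\<close>
  for all \<open>c < a + q\<close>, whereas \<open>unstacking c\<close> only needs \<open>restacking\<close> up to \<open>c - p - q\<close>.\<close>

lemma unstacking_restacking: "unstacking c \<and> restacking (c - q)"
proof (induction "nat c" arbitrary: c rule: less_induct)
  case less
  show ?case
  proof (cases "0 < c")
    case True
    \<comment> \<open>Since c is positive, the measure also decreases for negative c'.\<close>
    have IH: "unstacking c'" "restacking (c' - q)" if "c' < c" for c'
      using less[of c'] that True by auto
    have re: "restacking a" if "a < c - q" for a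
      using IH(2)[of "a + q"] that by simp
    show ?thesis using unstacking_step restacking_step[of "c - q"] IH(1) re by auto
  next
    case False
    then show ?thesis
      using q_nonneg by (auto simp: unstacking_def restacking_def optimal_nonpos)
  qed
qed

section \<open>Minimal solutions of the puzzle\<close>

lemma solution_optimal:
  assumes "0 \<le> n"
  shows "solution p q n (canon n PegA PegC (initial_state n))"
    and "length (canon n PegA PegC (initial_state n)) = m p q n"
    and "solution p q n ms \<Longrightarrow> optimal n PegA PegC (initial_state n) ms"
proof -
  have st: "is_state n (initial_state n)" "is_state n (final_state n)"
    by (auto simp: is_state_def initial_state_def final_state_def split: peg.splits)
  have ini: "peg_of (initial_state n) d = PegA" if "1 \<le> d" "d \<le> n" for d
    using that by (intro iffD1[OF mem_state_iff[OF st(1) that]]) (simp add: initial_state_def Delta_def)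
  have fin: "peg_of (final_state n) d = PegC" if "1 \<le> d" "d \<le> n" for d
    using that by (intro iffD1[OF mem_state_iff[OF st(2) that]]) (simp add: final_state_def Delta_def)
  have "relocate 1 n PegC (initial_state n) = final_state n"
    by (auto simp: relocate_def initial_state_def final_state_def fun_eq_iff split: peg.splits)
  then show "solution p q n (canon n PegA PegC (initial_state n))"
    "length (canon n PegA PegC (initial_state n)) = m p q n"
    using canon_path[OF st(1), of PegA PegC n] ini by (auto simp: solution_def)
  assume "solution p q n ms"
  then have path: "path (initial_state n) ms (final_state n)" by (simp add: solution_def)
  \<comment> \<open>In the case c = n no disk lies above the tower, and the bound n + p on leading
    disks holds because they are at most n and p >= 1.\<close>
  show "optimal n PegA PegC (initial_state n) ms"
    using unstacking_restacking[THEN conjunct1] path st(1)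
    by (rule unstackingD) (use ini fin path_lead_le[OF path] p_pos in \<open>fastforce+\<close>)
qed

end

theorem theorem3p2:
  fixes p q n :: int
  assumes "p \<ge> 1" and "q \<ge> 0" and "n \<ge> 0"
  shows "(\<exists>ms. solution p q n ms) \<and>
         (\<exists>!ms. minimal_solution p q n ms) \<and>
         (\<forall>ms. minimal_solution p q n ms \<longrightarrow> length ms = m p q n)"
proof -
  interpret hanoi p q n by standard (use assms in auto)
  let ?ms = "canon n PegA PegC (initial_state n)"
  note sol = solution_optimal[OF assms(3)]
  have ge: "m p q n \<le> length ms" "length ms = m p q n \<Longrightarrow> ms = ?ms" if "solution p q n ms" for ms
    using sol(3)[OF that] by (auto simp: optimal_def)
  have "minimal_solution p q n ms \<longleftrightarrow> ms = ?ms" for ms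
    unfolding minimal_solution_def using sol(1,2) ge by (metis le_antisym)
  then show ?thesis using sol(1,2) by auto
qed

end
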